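(* In the double auction described in the context, at the auctioneer the total payment collected from the buyers is no smaller than the overall price paid to the sellers, i.e., in every slot $t$, $$\sum_{i\in[1,F]}\big[\hat b_i^m(t)\,\hat\gamma_i^m(t)-\hat s_i^m(t)\,\hat\eta_i^m(t)\big]\ge 0,\qquad \forall m\in[1,M].$$
   Context: There are $F$ clouds and $M$ types of virtual machines (VMs). The double auction is run separately for each VM type $m$ in each slot $t$. Every cloud $i\in[1,F]=\{1,\dots,F\}$ submits a buy-bid with unit price $b_i^m(t)$ and quantity $\gamma_i^m(t)$, and a sell-bid with unit price $s_i^m(t)$ and quantity $\eta_i^m(t)$. The quantities are fixed to $\gamma_i^m(t)=\sum_{j\in[1,F]}C_j^mN_j^m$ and $\eta_i^m(t)=C_i^mN_i^m$, where $N_i^m$ is the number of servers for type-$m$ VMs at cloud $i$ and $C_i^m$ the maximum number of such VMs per server; the prices are chosen by the clouds. Let $\theta_j^m(t)$ be the $j$-th highest buy price and $\vartheta_j^m(t)$ the $j$-th lowest sell price (ties broken arbitrarily), with $L_j^m(t)$ the quantity of the sell-bid with $j$-th lowest price. Let $j'$ be the critical index: $\vartheta_{j'}^m(t)\le\theta_2^m(t)$ and $\vartheta_{j'+1}^m(t)>\theta_2^m(t)$ (i.e. $\vartheta_{j'}^m(t)$ is the last sell price in the sorted order not exceeding $\theta_2^m(t)$). Winners: if at least two sell prices are no higher than $\theta_2^m(t)$ (i.e. $\vartheta_2^m(t)\le\theta_2^m(t)$), then the highest buy-bid wins and the sell-bids ranked $1,\dots,j'-1$ win; otherwise no bid wins.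 Outcome: if $b_i^m(t)$ wins, the unit price charged to buyer $i$ is $\hat b_i^m(t)=\theta_2^m(t)$ and the number of VMs bought is $\hat\gamma_i^m(t)=\sum_{j=1}^{j'-1}L_j^m(t)$; otherwise both are $0$. If $s_i^m(t)$ wins, the unit price paid to seller $i$ is $\hat s_i^m(t)=\vartheta_{j'}^m(t)$ and the number of VMs sold is $\hat\eta_i^m(t)=\eta_i^m(t)$; otherwise both are $0$. *)

theory Defs
  imports Complex_Main
begin

text \<open>
  One run of the auction, i.e. a fixed VM type and a fixed slot. Clouds are the numbers
  \<open>1, \<dots>, clouds A\<close>. The fields \<open>buy_rank\<close> and \<open>sell_rank\<close> map a rank to the cloud
  holding that rank; they carry the (arbitrary) tie-breaking.
\<close>

record double_auction =
  clouds :: nat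
  buy_price :: "nat \<Rightarrow> real"
  buy_quantity :: "nat \<Rightarrow> nat"
  sell_price :: "nat \<Rightarrow> real"
  sell_quantity :: "nat \<Rightarrow> nat"
  buy_rank :: "nat \<Rightarrow> nat"
  sell_rank :: "nat \<Rightarrow> nat"

definition sorted_buy_price :: "double_auction \<Rightarrow> nat \<Rightarrow> real" where
  "sorted_buy_price A j = buy_price A (buy_rank A j)"

definition sorted_sell_price :: "double_auction \<Rightarrow> nat \<Rightarrow> real" where
  "sorted_sell_price A j = sell_price A (sell_rank A j)"

definition sorted_sell_quantity :: "double_auction \<Rightarrow> nat \<Rightarrow> nat" where
  "sorted_sell_quantity A j = sell_quantity A (sell_rank A j)"

definition valid_ranking :: "double_auction \<Rightarrow> bool" where
  "valid_ranking A \<longleftrightarrow>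
     bij_betw (buy_rank A) {1..clouds A} {1..clouds A} \<and>
     antimono_on {1..clouds A} (sorted_buy_price A) \<and>
     bij_betw (sell_rank A) {1..clouds A} {1..clouds A} \<and>
     mono_on {1..clouds A} (sorted_sell_price A)"

text \<open>
  With fewer than two clouds there are no second-ranked prices, hence no trade.
\<close>

definition trade :: "double_auction \<Rightarrow> bool" where
  "trade A \<longleftrightarrow> 2 \<le> clouds A \<and> sorted_sell_price A 2 \<le> sorted_buy_price A 2"

text \<open>
  The critical index is only meaningful if some sell price does not exceed the second highest
  buy price; it is used only under \<open>trade\<close>.
\<close>

definition critical_index :: "double_auction \<Rightarrow> nat" where
  "critical_index A = Max {j \<in> {1..clouds A}. sorted_sell_price A j \<le> sorted_buy_price A 2}"

definition buy_wins :: "double_auction \<Rightarrow> nat \<Rightarrow> bool" where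
  "buy_wins A i \<longleftrightarrow> trade A \<and> i = buy_rank A 1"

definition sell_wins :: "double_auction \<Rightarrow> nat \<Rightarrow> bool" where
  "sell_wins A i \<longleftrightarrow> trade A \<and> i \<in> sell_rank A ` {1..critical_index A - 1}"

definition charged_price :: "double_auction \<Rightarrow> nat \<Rightarrow> real" where
  "charged_price A i = (if buy_wins A i then sorted_buy_price A 2 else 0)"

definition bought :: "double_auction \<Rightarrow> nat \<Rightarrow> nat" where
  "bought A i =
     (if buy_wins A i then \<Sum>j = 1..critical_index A - 1. sorted_sell_quantity A j else 0)"

definition paid_price :: "double_auction \<Rightarrow> nat \<Rightarrow> real" where
  "paid_price A i = (if sell_wins A i then sorted_sell_price A (critical_index A) else 0)"

definition sold :: "double_auction \<Rightarrow> nat \<Rightarrow> nat" where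
  "sold A i = (if sell_wins A i then sell_quantity A i else 0)"

text \<open>
  The auction for VM type \<open>m\<close> in slot \<open>t\<close>: cloud \<open>i\<close> has \<open>N i m\<close> servers for type-\<open>m\<close> VMs,
  each hosting at most \<open>C i m\<close> of them, and bids the unit prices \<open>b i m t\<close> (buy) and
  \<open>s i m t\<close> (sell). The rankings \<open>r m t\<close> and \<open>q m t\<close> order the buy-bids and the sell-bids.
\<close>

definition cloud_auction ::
  "nat \<Rightarrow> (nat \<Rightarrow> nat \<Rightarrow> nat) \<Rightarrow> (nat \<Rightarrow> nat \<Rightarrow> nat) \<Rightarrow>
   (nat \<Rightarrow> nat \<Rightarrow> nat \<Rightarrow> real) \<Rightarrow> (nat \<Rightarrow> nat \<Rightarrow> nat \<Rightarrow> real) \<Rightarrow>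
   (nat \<Rightarrow> nat \<Rightarrow> nat \<Rightarrow> nat) \<Rightarrow> (nat \<Rightarrow> nat \<Rightarrow> nat \<Rightarrow> nat) \<Rightarrow>
   nat \<Rightarrow> nat \<Rightarrow> double_auction" where
  "cloud_auction F C N b s r q m t =
     \<lparr> clouds = F,
       buy_price = (\<lambda>i. b i m t),
       buy_quantity = (\<lambda>i. \<Sum>j = 1..F. C j m * N j m),
       sell_price = (\<lambda>i. s i m t),
       sell_quantity = (\<lambda>i. C i m * N i m),
       buy_rank = r m t,
       sell_rank = q m t \<rparr>"

lemma critical_index_bounds:
  assumes "trade A"
  shows "2 \<le> critical_index A" "critical_index A \<le> clouds A"
    "sorted_sell_price A (critical_index A) \<le> sorted_buy_price A 2"
proof -
  let ?S = "{j \<in> {1..clouds A}. sorted_sell_price A j \<le> sorted_buy_price A 2}"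
  have "2 \<in> ?S" "finite ?S"
    using assms by (auto simp: trade_def)
  then have "critical_index A \<in> ?S" "2 \<le> critical_index A"
    unfolding critical_index_def using Max_in[of ?S] Max_ge[of ?S 2] by blast+
  then show "2 \<le> critical_index A" "critical_index A \<le> clouds A"
    "sorted_sell_price A (critical_index A) \<le> sorted_buy_price A 2"
    by auto
qed

lemma critical_index_next:
  assumes "critical_index A < clouds A"
  shows "sorted_buy_price A 2 < sorted_sell_price A (critical_index A + 1)"
proof (rule ccontr)
  assume "\<not> ?thesis"
  then have "critical_index A + 1 \<le> critical_index A"
    using assms by (subst (2) critical_index_def, intro Max_ge) auto
  then show False by simp
qed

end

theory Submission
  imports Defs
begin

text \<open>
  Both sides of the market trade the same number \<open>Q\<close> of VMs: the single winning buyer buys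
  exactly what the winning sellers sell. The buyer pays the second highest buy price for each
  of them, each seller receives the critical sell price, and the critical index is chosen so
  that the latter does not exceed the former.
\<close>

definition traded_quantity :: "double_auction \<Rightarrow> nat" where
  "traded_quantity A = (\<Sum>j = 1..critical_index A - 1. sorted_sell_quantity A j)"

lemma total_charged:
  assumes "valid_ranking A" "trade A"
  shows "(\<Sum>i = 1..clouds A. charged_price A i * real (bought A i)) =
    sorted_buy_price A 2 * real (traded_quantity A)"
proof -
  \<comment> \<open>The sum has one possibly nonzero term, at the top-ranked buyer, and collapses to
    it only if that cloud lies in the summation range. Rank 1 exists since \<open>trade\<close>
    forces at least two clouds.\<close>
  have "buy_rank A 1 \<in> {1..clouds A}"
    using assms by (intro bij_betw_apply[of "buy_rank A"]) (auto simp: valid_ranking_def trade_def)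
  moreover have "charged_price A i * real (bought A i) =
      (if i = buy_rank A 1 then sorted_buy_price A 2 * real (traded_quantity A) else 0)" for i
    using assms(2) by (simp add: charged_price_def bought_def buy_wins_def traded_quantity_def)
  ultimately show ?thesis
    by simp
qed

text \<open>All winning sellers receive the same unit price, so it factors out. Injectivity of
  \<open>sell_rank\<close> lets the sum over winning clouds be taken over ranks, with no quantity
  counted twice.\<close>

lemma total_paid:
  assumes "valid_ranking A" "trade A"
  shows "(\<Sum>i = 1..clouds A. paid_price A i * real (sold A i)) =
    sorted_sell_price A (critical_index A) * real (traded_quantity A)"
proof -
  let ?J = "{1..critical_index A - 1}" and ?p = "sorted_sell_price A (critical_index A)"
  have sub: "?J \<subseteq> {1..clouds A}"
    using critical_index_bounds(2)[OF assms(2)] by auto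
  have bij: "bij_betw (sell_rank A) {1..clouds A} {1..clouds A}"
    using assms(1) by (simp add: valid_ranking_def)
  have inj: "inj_on (sell_rank A) ?J"
    using bij sub by (meson bij_betw_imp_inj_on inj_on_subset)
  have img: "sell_rank A ` ?J \<subseteq> {1..clouds A}"
    using bij sub by (metis bij_betw_imp_surj_on image_mono)
  \<comment> \<open>Losing sellers drop out because their \<open>paid_price\<close> defaults to
    0.\<close>
  have "(\<Sum>i = 1..clouds A. paid_price A i * real (sold A i)) =
      (\<Sum>i \<in> sell_rank A ` ?J. paid_price A i * real (sold A i))"
    using img by (intro sum.mono_neutral_right) (auto simp: paid_price_def sell_wins_def)
  also have "\<dots> = (\<Sum>i \<in> sell_rank A ` ?J. ?p * real (sell_quantity A i))"
    using assms(2) by (intro sum.cong) (auto simp: paid_price_def sold_def sell_wins_def)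
  also have "\<dots> = (\<Sum>j \<in> ?J. ?p * real (sorted_sell_quantity A j))"
    unfolding sum.reindex[OF inj] by (simp add: sorted_sell_quantity_def)
  finally show ?thesis
    by (simp add: traded_quantity_def sum_distrib_left)
qed

lemma auctioneer_budget_nonneg:
  assumes "valid_ranking A"
  shows "(\<Sum>i = 1..clouds A. charged_price A i * real (bought A i)
    - paid_price A i * real (sold A i)) \<ge> 0"
proof (cases "trade A")
  \<comment> \<open>Both totals carry the same nonnegative factor \<open>traded_quantity A\<close>,
    so comparing the two unit prices suffices.\<close>
  case True
  then show ?thesis
    using critical_index_bounds(3)[OF True]
    unfolding sum_subtractf total_charged[OF assms True] total_paid[OF assms True]
    by (simp add: mult_right_mono)
next
  \<comment> \<open>Nobody wins, so both prices default to 0 and every summand vanishes.\<close>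
  case False
  then show ?thesis
    by (simp add: charged_price_def paid_price_def buy_wins_def sell_wins_def)
qed

theorem theorem4:
  fixes F M :: nat
    and C N :: "nat \<Rightarrow> nat \<Rightarrow> nat"
    and b s :: "nat \<Rightarrow> nat \<Rightarrow> nat \<Rightarrow> real"
    and r q :: "nat \<Rightarrow> nat \<Rightarrow> nat \<Rightarrow> nat"
  defines "A \<equiv> cloud_auction F C N b s r q"
  assumes "\<And>m t. m \<in> {1..M} \<Longrightarrow> valid_ranking (A m t)"
  shows "\<forall>t. \<forall>m\<in>{1..M}.
    (\<Sum>i = 1..F. charged_price (A m t) i * real (bought (A m t) i)
               - paid_price (A m t) i * real (sold (A m t) i)) \<ge> 0"
proof (intro allI ballI)
  fix t m assume "m \<in> {1..M}"
  moreover have "clouds (A m t) = F"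
    by (simp add: A_def cloud_auction_def)
  ultimately show "(\<Sum>i = 1..F. charged_price (A m t) i * real (bought (A m t) i)
      - paid_price (A m t) i * real (sold (A m t) i)) \<ge> 0"
    using auctioneer_budget_nonneg[OF assms(2)] by metis
qed

end
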